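(* For every integer $k\geq 0$ there is a sequence $(u_\nu)_{\nu\in\mathbb{N}}$ in $C_{\mathrm{c}}^{k+1}(B_{1/2},\mathbb{C})$ such that $\|\overline{\partial}u_\nu\|_{C^k}$ is bounded uniformly in $\nu$, but $\|u_\nu\|_{C^{k+1}}\rightarrow\infty$ as $\nu\rightarrow\infty$.
   Context: $B_{1/2}\subset\mathbb{C}$ is the open disc of radius $1/2$ centred at $0$. $C_{\mathrm{c}}^{k+1}(B_{1/2},\mathbb{C})$ is the space of compactly supported maps $B_{1/2}\to\mathbb{C}$ that are $k+1$ times continuously differentiable in the real sense, with respect to $z=x+\mathrm{i}y$. The Cauchy--Riemann operator is $\overline{\partial}:=\frac{1}{2}(\partial_x+\mathrm{i}\,\partial_y)$. The norm $\|\cdot\|_{C^k}$ is the usual $C^k$-norm, i.e. the sum (equivalently, maximum) of the suprema over $B_{1/2}$ of the absolute values of all real partial derivatives of order at most $k$. *)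

theory Defs
  imports "HOL-Analysis.Analysis"
begin

definition partial_x :: "(complex \<Rightarrow> complex) \<Rightarrow> complex \<Rightarrow> complex" where
  "partial_x u z = vector_derivative (\<lambda>x. u (Complex x (Im z))) (at (Re z))"

definition partial_y :: "(complex \<Rightarrow> complex) \<Rightarrow> complex \<Rightarrow> complex" where
  "partial_y u z = vector_derivative (\<lambda>y. u (Complex (Re z) y)) (at (Im z))"

definition dbar :: "(complex \<Rightarrow> complex) \<Rightarrow> complex \<Rightarrow> complex" where
  "dbar u z = (partial_x u z + \<i> * partial_y u z) / 2"

(* Intended for open S.  Differentiability is that of the library predicate differentiable_on,
   which is over the reals, with complex regarded as a two-dimensional real vector space. *)
primrec Ck_on :: "nat \<Rightarrow> complex set \<Rightarrow> (complex \<Rightarrow> complex) \<Rightarrow> bool" where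
  "Ck_on 0 S u \<longleftrightarrow> continuous_on S u"
| "Ck_on (Suc k) S u \<longleftrightarrow>
     u differentiable_on S \<and> Ck_on k S (partial_x u) \<and> Ck_on k S (partial_y u)"

(* A compactly supported function on S is represented by its extension by zero to the
   whole plane, so that its support in S is the closure in the plane of its nonzero set. *)
definition Ck_compact :: "nat \<Rightarrow> complex set \<Rightarrow> (complex \<Rightarrow> complex) set" where
  "Ck_compact k S =
     {u. Ck_on k S u \<and> compact (closure {z. u z \<noteq> 0}) \<and> closure {z. u z \<noteq> 0} \<subseteq> S}"

(* The supremum is the real-valued SUP, which is meaningful only if the partial derivatives
   in question are bounded on S, as is the case for elements of Ck_compact k S.
   For functions of class C^k the order of differentiation is immaterial, so each partial
   derivative of order at most k is listed once, as (d/dx)^a (d/dy)^b with a + b \<le> k. *)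
definition Ck_norm :: "nat \<Rightarrow> complex set \<Rightarrow> (complex \<Rightarrow> complex) \<Rightarrow> real" where
  "Ck_norm k S u =
     (\<Sum>(a, b) \<in> {(a, b). a + b \<le> k}. SUP z\<in>S. norm ((partial_x ^^ a) ((partial_y ^^ b) u) z))"

end

(* Let phi(z) = z^n chi(z) with n = k + 1 and a cutoff chi equal to 1 near 0, and superpose its
   dyadic rescalings: u_nu(z) = sum over j < nu of 2^(-jn) phi(2^j z).  All terms contribute the
   same amount n! to the n-th x-derivative at 0, so the C^(k+1)-norm is at least nu n!.  On the
   other hand dbar phi = z^n dbar chi vanishes near 0, so the terms 2^(-jk) (dbar phi)(2^j z) of
   dbar u_nu have pairwise disjoint supports, and their derivatives of order at most k are
   bounded by those of dbar phi. *)
theory Submission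
  imports Defs
begin

section \<open>Partial derivatives: Frechet derivatives, locality, rescaling\<close>

text \<open>Chain rule along the horizontal and the vertical line through \<open>z\<close>. It
  reduces every later computation of partials to a Frechet derivative evaluated at \<open>1\<close>
  and \<open>\<i>\<close>.\<close>

lemma partial_eq:
  assumes "(u has_derivative u') (at z)"
  shows partial_x_eq: "partial_x u z = u' 1" and partial_y_eq: "partial_y u z = u' \<i>"
proof -
  interpret bounded_linear u' using assms by (rule has_derivative_bounded_linear)
  have z: "Complex (Re z) (Im z) = z" by simp
  have "((\<lambda>x. Complex x (Im z)) has_derivative (\<lambda>h. of_real h)) (at (Re z))"
    unfolding Complex_eq by (auto intro!: derivative_eq_intros)
  then have "((\<lambda>x. u (Complex x (Im z))) has_derivative (\<lambda>h. u' (of_real h))) (at (Re z))"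
    by (rule has_derivative_compose) (simp add: assms)
  moreover have "(\<lambda>h. u' (of_real h)) = (\<lambda>h. h *\<^sub>R u' 1)"
    by (simp add: of_real_def scaleR)
  ultimately show "partial_x u z = u' 1"
    unfolding partial_x_def by (intro vector_derivative_at) (simp add: has_vector_derivative_def)
  have "((\<lambda>y. Complex (Re z) y) has_derivative (\<lambda>h. of_real h * \<i>)) (at (Im z))"
    unfolding Complex_eq by (auto intro!: derivative_eq_intros)
  then have "((\<lambda>y. u (Complex (Re z) y)) has_derivative (\<lambda>h. u' (of_real h * \<i>))) (at (Im z))"
    by (rule has_derivative_compose) (simp add: assms)
  moreover have "(\<lambda>h. u' (of_real h * \<i>)) = (\<lambda>h. h *\<^sub>R u' \<i>)"
    by (simp add: scaleR flip: scaleR_conv_of_real)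
  ultimately show "partial_y u z = u' \<i>"
    unfolding partial_y_def by (intro vector_derivative_at) (simp add: has_vector_derivative_def)
qed

text \<open>Partials depend only on the germ at \<open>z\<close>. This allows a function to be
  replaced by \<open>z ^ n\<close> near the origin and by zero far out.\<close>

lemma partial_cong:
  assumes "open S" "\<And>w. w \<in> S \<Longrightarrow> u w = v w" "z \<in> S"
  shows partial_x_cong: "partial_x u z = partial_x v z"
    and partial_y_cong: "partial_y u z = partial_y v z"
proof -
  have ev: "\<forall>\<^sub>F w in nhds z. u w = v w"
    using assms eventually_nhds by blast
  have "((\<lambda>x. Complex x (Im z)) \<longlongrightarrow> Complex (Re z) (Im z)) (nhds (Re z))"
    unfolding Complex_eq by (intro tendsto_intros filterlim_ident)
  then have "\<forall>\<^sub>F x in nhds (Re z). u (Complex x (Im z)) = v (Complex x (Im z))"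
    using ev by (auto simp: filterlim_iff)
  then show "partial_x u z = partial_x v z"
    unfolding partial_x_def by (intro vector_derivative_cong_eq) auto
  have "((\<lambda>y. Complex (Re z) y) \<longlongrightarrow> Complex (Re z) (Im z)) (nhds (Im z))"
    unfolding Complex_eq by (intro tendsto_intros filterlim_ident)
  then have "\<forall>\<^sub>F y in nhds (Im z). u (Complex (Re z) y) = v (Complex (Re z) y)"
    using ev by (auto simp: filterlim_iff)
  then show "partial_y u z = partial_y v z"
    unfolding partial_y_def by (intro vector_derivative_cong_eq) auto
qed

lemma dbar_cong:
  assumes "open S" "\<And>w. w \<in> S \<Longrightarrow> u w = v w" "z \<in> S"
  shows "dbar u z = dbar v z"
  using partial_cong[OF assms] by (simp add: dbar_def)

text \<open>Named after the summand of \<open>Ck_norm\<close>, with the y-derivatives taken first as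
  there.\<close>

definition mixed :: "nat \<Rightarrow> nat \<Rightarrow> (complex \<Rightarrow> complex) \<Rightarrow> complex \<Rightarrow> complex" where
  "mixed a b u = (partial_x ^^ a) ((partial_y ^^ b) u)"

lemma mixed_cong:
  assumes "open S" "\<And>w. w \<in> S \<Longrightarrow> u w = v w" "z \<in> S"
  shows "mixed a b u z = mixed a b v z"
proof -
  \<comment> \<open>Equality is carried on all of the open set \<open>S\<close>, since the next
    derivative at a point uses the values around it.\<close>
  have y: "(partial_y ^^ b) u w = (partial_y ^^ b) v w" if "w \<in> S" for w
    using that
  proof (induction b arbitrary: w)
    case (Suc b)
    show ?case using Suc by (auto intro!: partial_y_cong[OF assms(1)])
  qed (use assms in auto)
  have "(partial_x ^^ a) ((partial_y ^^ b) u) w = (partial_x ^^ a) ((partial_y ^^ b) v) w"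
    if "w \<in> S" for w
    using that
  proof (induction a arbitrary: w)
    case (Suc a)
    show ?case using Suc by (auto intro!: partial_x_cong[OF assms(1)])
  qed (use y in auto)
  then show ?thesis using assms(3) by (simp add: mixed_def)
qed

lemma partial_const [simp]: "partial_x (\<lambda>z. c) = (\<lambda>z. 0)" "partial_y (\<lambda>z. c) = (\<lambda>z. 0)"
  by (auto simp: fun_eq_iff partial_x_eq[OF has_derivative_const] partial_y_eq[OF has_derivative_const])

lemma mixed_zero [simp]: "mixed a b (\<lambda>z. 0) = (\<lambda>z. 0)"
proof -
  have "(partial_y ^^ b) (\<lambda>z. 0) = (\<lambda>z. 0)" by (induction b) auto
  moreover have "(partial_x ^^ a) (\<lambda>z. 0) = (\<lambda>z. 0)" by (induction a) auto
  ultimately show ?thesis by (simp add: mixed_def)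
qed

lemma dbar_zero [simp]: "dbar (\<lambda>z. 0) = (\<lambda>z. 0)"
  by (simp add: dbar_def fun_eq_iff)

lemma differentiable_on_UNIV_D:
  assumes "u differentiable_on UNIV"
  obtains u' where "(u has_derivative u') (at z)"
  using assms by (auto simp: differentiable_on_def differentiable_def)

lemma partialI:
  assumes "\<And>z. \<exists>D. (u has_derivative D) (at z) \<and> D 1 = p z \<and> D \<i> = q z"
  shows "u differentiable_on UNIV" "partial_x u = p" "partial_y u = q"
proof -
  have *: "u differentiable at z \<and> partial_x u z = p z \<and> partial_y u z = q z" for z
    using assms[of z] by (auto simp: differentiable_def partial_x_eq partial_y_eq)
  then show "u differentiable_on UNIV" "partial_x u = p" "partial_y u = q"
    by (auto simp: differentiable_on_def fun_eq_iff)
qed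

text \<open>The shape \<open>u z + c * v (r * z)\<close> is that of one step of the dyadic
  recursion. Differentiation reproduces it with \<open>c * r\<close> in place of \<open>c\<close>,
  so the rule can be iterated; \<open>r = 1\<close> covers plain sums.\<close>

lemma partial_add_scaled:
  fixes r :: real
  assumes "u differentiable_on UNIV" "v differentiable_on UNIV"
  shows "(\<lambda>z. u z + c * v (of_real r * z)) differentiable_on UNIV"
    and "partial_x (\<lambda>z. u z + c * v (of_real r * z))
           = (\<lambda>z. partial_x u z + (c * of_real r) * partial_x v (of_real r * z))"
    and "partial_y (\<lambda>z. u z + c * v (of_real r * z))
           = (\<lambda>z. partial_y u z + (c * of_real r) * partial_y v (of_real r * z))"
proof -
  have *: "\<exists>D. ((\<lambda>z. u z + c * v (of_real r * z)) has_derivative D) (at z)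
      \<and> D 1 = partial_x u z + (c * of_real r) * partial_x v (of_real r * z)
      \<and> D \<i> = partial_y u z + (c * of_real r) * partial_y v (of_real r * z)" for z
  proof -
    obtain u' where u: "(u has_derivative u') (at z)"
      using assms(1) by (rule differentiable_on_UNIV_D)
    obtain v' where v: "(v has_derivative v') (at (of_real r * z))"
      using assms(2) by (rule differentiable_on_UNIV_D)
    interpret v': bounded_linear v' using v by (rule has_derivative_bounded_linear)
    have "((\<lambda>z. of_real r * z) has_derivative (\<lambda>h. of_real r * h)) (at z)"
      by (auto intro!: derivative_eq_intros)
    then have "((\<lambda>z. v (of_real r * z)) has_derivative (\<lambda>h. v' (of_real r * h))) (at z)"
      by (rule has_derivative_compose) (rule v)
    then have "((\<lambda>z. u z + c * v (of_real r * z))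
        has_derivative (\<lambda>h. u' h + c * v' (of_real r * h))) (at z)"
      by (intro has_derivative_add u has_derivative_mult_right)
    \<comment> \<open>\<open>v'\<close> is only real-linear; the factor can be pulled out because
      \<open>r\<close> is real.\<close>
    moreover have "v' (of_real r * h) = of_real r * v' h" for h
      using v'.scaleR[of r h] by (simp add: scaleR_conv_of_real)
    from this[of 1] this[of \<i>] have "v' (of_real r) = of_real r * v' 1" "v' (of_real r * \<i>) = of_real r * v' \<i>"
      by simp_all
    ultimately show ?thesis
      by (intro exI[of _ "\<lambda>h. u' h + c * v' (of_real r * h)"])
        (simp add: partial_x_eq[OF u] partial_x_eq[OF v] partial_y_eq[OF u] partial_y_eq[OF v])
  qed
  show "(\<lambda>z. u z + c * v (of_real r * z)) differentiable_on UNIV"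
    by (rule partialI[OF *])
  show "partial_x (\<lambda>z. u z + c * v (of_real r * z))
           = (\<lambda>z. partial_x u z + (c * of_real r) * partial_x v (of_real r * z))"
    by (rule partialI[OF *])
  show "partial_y (\<lambda>z. u z + c * v (of_real r * z))
           = (\<lambda>z. partial_y u z + (c * of_real r) * partial_y v (of_real r * z))"
    by (rule partialI[OF *])
qed

lemma dbar_add_scaled:
  fixes r :: real
  assumes "u differentiable_on UNIV" "v differentiable_on UNIV"
  shows "dbar (\<lambda>z. u z + c * v (of_real r * z))
           = (\<lambda>z. dbar u z + (c * of_real r) * dbar v (of_real r * z))"
  unfolding dbar_def partial_add_scaled(2,3)[OF assms]
  by (simp add: fun_eq_iff algebra_simps add_divide_distrib)

section \<open>Closure properties of the class C^n\<close>

lemma Ck_continuous: "Ck_on n S u \<Longrightarrow> continuous_on S u"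
  by (cases n) (auto intro: differentiable_imp_continuous_on)

lemma Ck_Suc_imp: "Ck_on (Suc n) S u \<Longrightarrow> Ck_on n S u"
proof (induction n arbitrary: u)
  case (Suc n)
  show ?case
    using Suc.prems Suc.IH[of "partial_x u"] Suc.IH[of "partial_y u"] by auto
qed (simp add: differentiable_imp_continuous_on)

lemma Ck_subset: "Ck_on n T u \<Longrightarrow> S \<subseteq> T \<Longrightarrow> Ck_on n S u"
proof (induction n arbitrary: u)
  case 0
  then show ?case using continuous_on_subset by simp
next
  case (Suc n)
  then show ?case using differentiable_on_subset[of u T S] by simp
qed

lemma Ck_const: "Ck_on n UNIV (\<lambda>z. c)"
  by (induction n arbitrary: c) auto

lemma Ck_linear:
  assumes "bounded_linear f"
  shows "Ck_on n UNIV f"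
proof -
  have d: "(f has_derivative f) (at z)" for z
    using assms by (rule bounded_linear_imp_has_derivative)
  have "partial_x f = (\<lambda>z. f 1)" "partial_y f = (\<lambda>z. f \<i>)"
    by (auto simp: fun_eq_iff partial_x_eq[OF d] partial_y_eq[OF d])
  moreover have "f differentiable_on UNIV"
    using d by (auto simp: differentiable_on_def differentiable_def)
  ultimately show ?thesis
    by (cases n) (auto simp: Ck_const intro: differentiable_imp_continuous_on)
qed

lemma Ck_add_scaled:
  fixes r :: real
  assumes "Ck_on n UNIV u" "Ck_on n UNIV v"
  shows "Ck_on n UNIV (\<lambda>z. u z + c * v (of_real r * z))"
  using assms
\<comment> \<open>\<open>c\<close> has to vary because the partials carry the coefficient
  \<open>c * r\<close>.\<close>
proof (induction n arbitrary: u v c)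
  case 0
  have "continuous_on UNIV (\<lambda>z. v (of_real r * z))"
    by (rule continuous_on_compose2[of UNIV v]) (use 0 in \<open>auto intro: continuous_on_mult_left continuous_on_id\<close>)
  with 0 show ?case by (simp add: continuous_on_add continuous_on_mult_left)
next
  case (Suc n)
  then have d: "u differentiable_on UNIV" "v differentiable_on UNIV" by auto
  show ?case
    unfolding Ck_on.simps partial_add_scaled(2,3)[OF d]
    using Suc.prems by (intro conjI partial_add_scaled(1)[OF d] Suc.IH) auto
qed

lemma Ck_add: "Ck_on n UNIV u \<Longrightarrow> Ck_on n UNIV v \<Longrightarrow> Ck_on n UNIV (\<lambda>z. u z + v z)"
  using Ck_add_scaled[of n u v 1 1] by simp

lemma Ck_mult:
  assumes "Ck_on n UNIV u" "Ck_on n UNIV v"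
  shows "Ck_on n UNIV (\<lambda>z. u z * v z)"
  using assms
proof (induction n arbitrary: u v)
  case 0
  then show ?case by (auto intro!: continuous_intros)
next
  case (Suc n)
  have d: "u differentiable_on UNIV" "v differentiable_on UNIV"
    using Suc.prems by auto
  have *: "\<exists>D. ((\<lambda>z. u z * v z) has_derivative D) (at z)
      \<and> D 1 = u z * partial_x v z + partial_x u z * v z
      \<and> D \<i> = u z * partial_y v z + partial_y u z * v z" for z
  proof -
    obtain u' where u: "(u has_derivative u') (at z)"
      using d(1) by (rule differentiable_on_UNIV_D)
    obtain v' where v: "(v has_derivative v') (at z)"
      using d(2) by (rule differentiable_on_UNIV_D)
    show ?thesis
      using has_derivative_mult[OF u v]
      by (auto simp: partial_x_eq[OF u] partial_x_eq[OF v] partial_y_eq[OF u] partial_y_eq[OF v])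
  qed
  have "(\<lambda>z. u z * v z) differentiable_on UNIV"
    by (rule partialI[OF *])
  moreover have "partial_x (\<lambda>z. u z * v z) = (\<lambda>z. u z * partial_x v z + partial_x u z * v z)"
    by (rule partialI[OF *])
  moreover have "partial_y (\<lambda>z. u z * v z) = (\<lambda>z. u z * partial_y v z + partial_y u z * v z)"
    by (rule partialI[OF *])
  \<comment> \<open>The undifferentiated factors are lowered to class \<open>n\<close> so that the
    induction hypothesis applies to each product.\<close>
  moreover have "Ck_on n UNIV (\<lambda>z. u z * partial_x v z + partial_x u z * v z)"
    "Ck_on n UNIV (\<lambda>z. u z * partial_y v z + partial_y u z * v z)"
    using Suc.prems Ck_Suc_imp[OF Suc.prems(1)] Ck_Suc_imp[OF Suc.prems(2)]
    by (auto intro!: Ck_add Suc.IH)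
  ultimately show ?case by simp
qed

lemma Ck_power: "Ck_on n UNIV (\<lambda>z. z ^ m)"
proof (induction m)
  case (Suc m)
  then show ?case unfolding power_Suc by (rule Ck_mult[OF Ck_linear[OF bounded_linear_ident]])
qed (simp add: Ck_const)

section \<open>Truncated powers\<close>

text \<open>Away from 0 the function is locally zero or a monomial. At 0 the exponent is at least 2,
  so the difference quotient is itself a truncated power of positive exponent and tends to
  0.\<close>

lemma DERIV_max_power:
  "((\<lambda>t::real. max 0 t ^ Suc (Suc m)) has_field_derivative real (Suc (Suc m)) * max 0 t ^ Suc m) (at t)"
proof (cases t "0::real" rule: linorder_cases)
  case less
  have "((\<lambda>t::real. 0) has_field_derivative real (Suc (Suc m)) * max 0 t ^ Suc m) (at t)"
    using less by simp
  then show ?thesis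
    by (rule has_field_derivative_transform_within_open[where S = "{..<0}"]) (use less in auto)
next
  case greater
  have "((\<lambda>t::real. t ^ Suc (Suc m)) has_field_derivative real (Suc (Suc m)) * max 0 t ^ Suc m) (at t)"
    using greater DERIV_power[OF DERIV_ident, of "Suc (Suc m)" t UNIV]
    by (simp del: of_nat_Suc power_Suc)
  then show ?thesis
    by (rule has_field_derivative_transform_within_open[where S = "{0<..}"]) (use greater in auto)
next
  case equal
  have "((\<lambda>h::real. max 0 h ^ Suc m) \<longlongrightarrow> max 0 0 ^ Suc m) (at 0)"
    by (intro tendsto_intros)
  then have "((\<lambda>h::real. max 0 h ^ Suc m) \<longlongrightarrow> 0) (at 0)"
    by simp
  moreover have "max 0 h ^ Suc (Suc m) / h = max 0 h ^ Suc m" if "h \<noteq> 0" for h :: real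
    using that by (cases "h > 0") (auto simp: max_def)
  ultimately have "((\<lambda>h::real. max 0 h ^ Suc (Suc m) / h) \<longlongrightarrow> 0) (at 0)"
    by (subst tendsto_cong[where g = "\<lambda>h. max 0 h ^ Suc m"])
      (auto simp: eventually_at_filter simp del: power_Suc)
  then show ?thesis
    using equal by (simp add: DERIV_def del: power_Suc)
qed

text \<open>Each differentiation lowers the exponent by one and brings out a partial of
  \<open>f\<close>. With \<open>n < m\<close> the exponent is still positive after \<open>n\<close>
  differentiations, and continuity remains.\<close>

lemma Ck_max_power:
  fixes f :: "complex \<Rightarrow> real"
  assumes "Ck_on n UNIV (\<lambda>z. complex_of_real (f z))" "n < m"
  shows "Ck_on n UNIV (\<lambda>z. complex_of_real (max 0 (f z) ^ m))"
  using assms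
proof (induction n arbitrary: m)
  case 0
  then have "continuous_on UNIV (\<lambda>z. Re (complex_of_real (f z)))"
    by (intro continuous_on_Re) simp
  then have "continuous_on UNIV f" by simp
  then show ?case
    by (simp del: of_real_power)
      (intro continuous_on_of_real continuous_on_power continuous_on_max continuous_on_const)
next
  case (Suc n)
  \<comment> \<open>The subtraction is not cut off at zero: \<open>Suc n < m\<close> gives
    \<open>m \<ge> 2\<close>.\<close>
  define l where "l = m - 2"
  have m: "m = Suc (Suc l)" and l: "n < Suc l"
    using Suc.prems(2) by (auto simp: l_def)
  let ?F = "\<lambda>z. complex_of_real (f z)"
  let ?q = "\<lambda>z. complex_of_real (real m) * complex_of_real (max 0 (f z) ^ Suc l)"
  have d: "?F differentiable_on UNIV" using Suc.prems by simp
  have *: "\<exists>D. ((\<lambda>z. complex_of_real (max 0 (f z) ^ m)) has_derivative D) (at z)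
      \<and> D 1 = ?q z * partial_x ?F z \<and> D \<i> = ?q z * partial_y ?F z" for z
  proof -
    obtain F' where "(?F has_derivative F') (at z)"
      using d by (rule differentiable_on_UNIV_D)
    then have f: "(f has_derivative (\<lambda>h. Re (F' h))) (at z)"
      using has_derivative_Re[of ?F F'] by simp
    \<comment> \<open>With this form of the derivative, the partials of \<open>?F\<close> are
      visibly the real numbers that the chain rule for \<open>f\<close> produces.\<close>
    have F: "(?F has_derivative (\<lambda>h. of_real (Re (F' h)))) (at z)"
      using f by (rule has_derivative_of_real)
    have "((\<lambda>z. max 0 (f z) ^ m) has_derivative (\<lambda>h. real m * max 0 (f z) ^ Suc l * Re (F' h))) (at z)"
      using has_derivative_compose[OF f DERIV_max_power[THEN has_field_derivative_imp_has_derivative]]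
      by (simp add: m)
    from has_derivative_of_real[OF this, where 'a = complex]
    show ?thesis
      by (intro exI[of _ "\<lambda>h. of_real (real m * max 0 (f z) ^ Suc l * Re (F' h))"])
        (simp add: partial_x_eq[OF F] partial_y_eq[OF F])
  qed
  have q: "Ck_on n UNIV ?q"
    by (rule Ck_mult[OF Ck_const Suc.IH[OF Ck_Suc_imp[OF Suc.prems(1)] l]])
  have "(\<lambda>z. complex_of_real (max 0 (f z) ^ m)) differentiable_on UNIV"
    by (rule partialI[OF *])
  moreover have "partial_x (\<lambda>z. complex_of_real (max 0 (f z) ^ m)) = (\<lambda>z. ?q z * partial_x ?F z)"
    by (rule partialI[OF *])
  moreover have "partial_y (\<lambda>z. complex_of_real (max 0 (f z) ^ m)) = (\<lambda>z. ?q z * partial_y ?F z)"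
    by (rule partialI[OF *])
  moreover have "Ck_on n UNIV (\<lambda>z. ?q z * partial_x ?F z)" "Ck_on n UNIV (\<lambda>z. ?q z * partial_y ?F z)"
    by (rule Ck_mult[OF q], use Suc.prems(1) in simp)+
  ultimately show ?case by (simp only: Ck_on.simps simp_thms)
qed

section \<open>Iterated partial derivatives\<close>

lemma Ck_funpow_partial_x: "Ck_on n S u \<Longrightarrow> m \<le> n \<Longrightarrow> Ck_on (n - m) S ((partial_x ^^ m) u)"
proof (induction m)
  case (Suc m)
  then have "Ck_on (Suc (n - Suc m)) S ((partial_x ^^ m) u)"
    by (simp add: Suc_diff_Suc)
  then show ?case by simp
qed simp

lemma Ck_funpow_partial_y: "Ck_on n S u \<Longrightarrow> m \<le> n \<Longrightarrow> Ck_on (n - m) S ((partial_y ^^ m) u)"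
proof (induction m)
  case (Suc m)
  then have "Ck_on (Suc (n - Suc m)) S ((partial_y ^^ m) u)"
    by (simp add: Suc_diff_Suc)
  then show ?case by simp
qed simp

lemma continuous_mixed: "Ck_on n S u \<Longrightarrow> a + b \<le> n \<Longrightarrow> continuous_on S (mixed a b u)"
  unfolding mixed_def
  by (rule Ck_continuous, rule Ck_funpow_partial_x, erule Ck_funpow_partial_y) auto

lemma Ck_dbar: 
  assumes "Ck_on (Suc n) UNIV u"
  shows "Ck_on n UNIV (dbar u)"
proof -
  have "dbar u = (\<lambda>z. (1/2) * (partial_x u z + \<i> * partial_y u z))"
    by (simp add: dbar_def fun_eq_iff)
  moreover have "Ck_on n UNIV (\<lambda>z. (1/2) * (partial_x u z + \<i> * partial_y u z))"
    using assms by (intro Ck_mult Ck_add Ck_const) auto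
  ultimately show ?thesis by simp
qed

text \<open>Iterates \<open>partial_add_scaled\<close>. The gain \<open>r ^ (a + b)\<close> is what
  competes with the weight \<open>c\<close> of a rescaled term.\<close>

lemma mixed_add_scaled:
  fixes r :: real
  assumes "Ck_on n UNIV u" "Ck_on n UNIV v" "a + b \<le> n"
  shows "mixed a b (\<lambda>z. u z + c * v (of_real r * z))
           = (\<lambda>z. mixed a b u z + (c * of_real r ^ (a + b)) * mixed a b v (of_real r * z))"
proof -
  have y: "(partial_y ^^ b) (\<lambda>z. u z + c * v (of_real r * z))
      = (\<lambda>z. (partial_y ^^ b) u z + (c * of_real r ^ b) * (partial_y ^^ b) v (of_real r * z))"
    if "Ck_on n UNIV u" "Ck_on n UNIV v" "b \<le> n" for u v b n c
    using that
  proof (induction b)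
    case (Suc b)
    \<comment> \<open>Writing the remaining order as a successor exposes the differentiability
      needed for one more partial.\<close>
    have "Ck_on (Suc (n - Suc b)) UNIV ((partial_y ^^ b) u)" "Ck_on (Suc (n - Suc b)) UNIV ((partial_y ^^ b) v)"
      using Ck_funpow_partial_y[OF Suc.prems(1), of b] Ck_funpow_partial_y[OF Suc.prems(2), of b] Suc.prems(3)
      by (simp_all add: Suc_diff_Suc del: Ck_on.simps)
    then show ?case using Suc by (simp add: partial_add_scaled) (simp add: mult_ac)
  qed simp
  have x: "(partial_x ^^ b) (\<lambda>z. u z + c * v (of_real r * z))
      = (\<lambda>z. (partial_x ^^ b) u z + (c * of_real r ^ b) * (partial_x ^^ b) v (of_real r * z))"
    if "Ck_on n UNIV u" "Ck_on n UNIV v" "b \<le> n" for u v b n c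
    using that
  proof (induction b)
    case (Suc b)
    have "Ck_on (Suc (n - Suc b)) UNIV ((partial_x ^^ b) u)" "Ck_on (Suc (n - Suc b)) UNIV ((partial_x ^^ b) v)"
      using Ck_funpow_partial_x[OF Suc.prems(1), of b] Ck_funpow_partial_x[OF Suc.prems(2), of b] Suc.prems(3)
      by (simp_all add: Suc_diff_Suc del: Ck_on.simps)
    then show ?case using Suc by (simp add: partial_add_scaled) (simp add: mult_ac)
  qed simp
  show ?thesis
    unfolding mixed_def y[OF assms(1,2) add_leD2[OF assms(3)]]
    \<comment> \<open>The y-derivatives consume \<open>b\<close> of the \<open>n\<close> orders,
      leaving at least \<open>a\<close> for the x-derivatives.\<close>
    by (subst x[where n = "n - b"])
      (use assms Ck_funpow_partial_y in \<open>auto simp: power_add mult_ac\<close>)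
qed

text \<open>The quotient of factorials is the falling factorial; \<open>m = n\<close> yields the
  constant \<open>fact n\<close>.\<close>

lemma funpow_partial_x_power:
  "m \<le> n \<Longrightarrow> (partial_x ^^ m) (\<lambda>z. z ^ n) = (\<lambda>z. (fact n / fact (n - m)) * z ^ (n - m))"
proof (induction m)
  case (Suc m)
  define l where "l = n - Suc m"
  have l: "n - m = Suc l" using Suc.prems by (simp add: l_def)
  have p: "partial_x (\<lambda>z. c * z ^ Suc l) = (\<lambda>z. c * (of_nat (Suc l) * z ^ l))" for c
  proof
    fix z :: complex
    have "((\<lambda>z. c * z ^ Suc l) has_field_derivative c * (of_nat (Suc l) * z ^ l)) (at z)"
      using DERIV_cmult[OF DERIV_power[OF DERIV_ident, of "Suc l" z UNIV], of c]
      by (simp del: of_nat_Suc power_Suc)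
    from partial_x_eq[OF this[THEN has_field_derivative_imp_has_derivative]]
    show "partial_x (\<lambda>z. c * z ^ Suc l) z = c * (of_nat (Suc l) * z ^ l)" by simp
  qed
  have q: "(fact n / fact (Suc l)) * (of_nat (Suc l) * z ^ l) = (fact n / fact l) * z ^ l" for z :: complex
    by (simp add: divide_simps del: of_nat_Suc)
  have "(partial_x ^^ m) (\<lambda>z. z ^ n) = (\<lambda>z. (fact n / fact (Suc l)) * z ^ Suc l)"
    using Suc unfolding l by simp
  then show ?case
    by (simp only: funpow.simps o_apply p q l_def[symmetric])
qed simp

section \<open>The cutoff and the bump\<close>

text \<open>A cutoff of class C^n suffices, so truncated powers of exponent \<open>n + 1\<close> are
  used. The inner one vanishes for |z| \<le> 1/4, the outer one once 16|z|^2 \<ge> 2, that is from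
  radius sqrt(2)/4 < 3/8 on.\<close>

definition cutoff :: "nat \<Rightarrow> complex \<Rightarrow> real" where
  "cutoff n z = max 0 (1 - max 0 (16 * (cmod z)\<^sup>2 - 1) ^ Suc n) ^ Suc n"

lemma cutoff_eq_1: "cmod z < 1/4 \<Longrightarrow> cutoff n z = 1"
proof -
  assume "cmod z < 1/4"
  then have "(cmod z)\<^sup>2 < (1/4)\<^sup>2" by (intro power_strict_mono) auto
  then show ?thesis by (simp add: cutoff_def power2_eq_square)
qed

lemma cutoff_eq_0: "cmod z > 3/8 \<Longrightarrow> cutoff n z = 0"
proof -
  assume "cmod z > 3/8"
  then have "(cmod z)\<^sup>2 > (3/8)\<^sup>2" by (intro power_strict_mono) auto
  \<comment> \<open>At radius 3/8 the expression equals 9/4 - 1 = 5/4.\<close>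
  then have "max 0 (16 * (cmod z)\<^sup>2 - 1) \<ge> 1" by (simp add: power2_eq_square)
  then have "max 0 (16 * (cmod z)\<^sup>2 - 1) ^ Suc n \<ge> 1" by (rule one_le_power)
  then show ?thesis by (simp add: cutoff_def del: power_Suc)
qed

lemma Ck_cutoff: "Ck_on n UNIV (\<lambda>z. complex_of_real (cutoff n z))"
proof -
  have lin: "Ck_on n UNIV (\<lambda>z. complex_of_real (Re z))" "Ck_on n UNIV (\<lambda>z. complex_of_real (Im z))"
    by (auto intro!: Ck_linear bounded_linear_intros bounded_linear_Re bounded_linear_Im bounded_linear_of_real bounded_linear_compose[OF bounded_linear_of_real])
  \<comment> \<open>\<open>cmod\<close> is not differentiable at 0, but its square is a polynomial
    in \<open>Re z\<close> and \<open>Im z\<close>.\<close>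
  have "Ck_on n UNIV (\<lambda>z. complex_of_real 16 * (complex_of_real (Re z) * complex_of_real (Re z)
      + complex_of_real (Im z) * complex_of_real (Im z)) + complex_of_real (-1))"
    by (intro Ck_add Ck_mult Ck_const lin)
  moreover have "16 * (cmod z)\<^sup>2 - 1 = 16 * (Re z * Re z + Im z * Im z) + (-1)" for z
    by (simp add: cmod_power2 flip: power2_eq_square)
  ultimately have "Ck_on n UNIV (\<lambda>z. complex_of_real (16 * (cmod z)\<^sup>2 - 1))"
    by (simp only: of_real_add of_real_mult)
  then have "Ck_on n UNIV (\<lambda>z. complex_of_real (max 0 (16 * (cmod z)\<^sup>2 - 1) ^ Suc n))"
    by (rule Ck_max_power) simp
  then have "Ck_on n UNIV (\<lambda>z. 1 + (-1) * complex_of_real (max 0 (16 * (cmod z)\<^sup>2 - 1) ^ Suc n))"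
    by (intro Ck_add Ck_mult Ck_const)
  then have "Ck_on n UNIV (\<lambda>z. complex_of_real (1 - max 0 (16 * (cmod z)\<^sup>2 - 1) ^ Suc n))"
    by simp
  then show ?thesis unfolding cutoff_def by (rule Ck_max_power) simp
qed

definition bump :: "nat \<Rightarrow> complex \<Rightarrow> complex" where
  "bump n z = z ^ n * of_real (cutoff n z)"

lemma Ck_bump: "Ck_on n UNIV (bump n)"
  unfolding bump_def by (intro Ck_mult Ck_power Ck_cutoff)

lemma dbar_bump_inner:
  assumes "cmod z < 1/4"
  shows "dbar (bump n) z = 0"
proof -
  have "dbar (bump n) z = dbar (\<lambda>z. z ^ n) z"
    by (rule dbar_cong[where S = "ball 0 (1/4)"]) (use assms in \<open>auto simp: bump_def cutoff_eq_1\<close>)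
  also have "\<dots> = 0"
  proof -
    have d: "((\<lambda>z. z ^ n) has_derivative (\<lambda>h. (of_nat n * z ^ (n - 1)) * h)) (at z)"
      by (rule has_field_derivative_imp_has_derivative) (auto intro!: derivative_eq_intros)
    \<comment> \<open>Cauchy-Riemann: the derivative is multiplication by a complex number, so its
      value at \<open>\<i>\<close> is \<open>\<i>\<close> times its value at \<open>1\<close>, and
      the two terms of \<open>dbar\<close> cancel.\<close>
    show ?thesis by (simp add: dbar_def partial_x_eq[OF d] partial_y_eq[OF d] algebra_simps)
  qed
  finally show ?thesis .
qed

section \<open>The dyadic superposition\<close>

text \<open>The sum u_nu, written by splitting off its coarsest term: the remaining terms form a
  rescaled copy of the shorter sum. Each induction on \<open>\<nu>\<close> then deals with two
  summands only.\<close>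

primrec dyadic :: "nat \<Rightarrow> nat \<Rightarrow> complex \<Rightarrow> complex" where
  "dyadic n 0 = (\<lambda>z. 0)"
| "dyadic n (Suc \<nu>) = (\<lambda>z. bump n z + (1 / 2 ^ n) * dyadic n \<nu> (of_real 2 * z))"

lemma Ck_dyadic: "Ck_on n UNIV (dyadic n \<nu>)"
proof (induction \<nu>)
  case (Suc \<nu>)
  then show ?case unfolding dyadic.simps by (intro Ck_add_scaled Ck_bump)
qed (simp add: Ck_const)

lemma dyadic_eq_0: "cmod z > 3/8 \<Longrightarrow> dyadic n \<nu> z = 0"
proof (induction \<nu> arbitrary: z)
  case (Suc \<nu>)
  then have "dyadic n \<nu> (of_real 2 * z) = 0" by (intro Suc.IH) (simp add: norm_mult)
  then show ?case using Suc.prems by (simp add: bump_def cutoff_eq_0)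
qed simp

text \<open>For every \<open>\<nu>\<close> the support lies in the closed disc of radius 3/8, a
  compact subset of the open disc of radius 1/2.\<close>

lemma dyadic_Ck_compact: "dyadic n \<nu> \<in> Ck_compact n (ball 0 (1/2))"
proof -
  have "closure {z. dyadic n \<nu> z \<noteq> 0} \<subseteq> cball 0 (3/8)"
    by (rule closure_minimal) (use dyadic_eq_0 in \<open>force simp: not_less[symmetric]\<close>)+
  moreover from this have "compact (closure {z. dyadic n \<nu> z \<noteq> 0})"
    by (meson bounded_cball bounded_subset closed_closure compact_eq_bounded_closed)
  ultimately show ?thesis
    unfolding Ck_compact_def using Ck_subset[OF Ck_dyadic] by (auto simp: subset_iff)
qed

lemma mixed_dbar_outer:
  assumes "cmod z > 3/8"
  shows "mixed a b (dbar (dyadic n \<nu>)) z = 0"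
proof -
  have o: "open (- cball (0::complex) (3/8))" by (simp add: open_Compl)
  have "dbar (dyadic n \<nu>) w = 0" if "w \<in> - cball 0 (3/8)" for w
    using dbar_cong[OF o _ that, of "dyadic n \<nu>" "\<lambda>z. 0"] dyadic_eq_0 by simp
  then show ?thesis
    using mixed_cong[OF o, of "dbar (dyadic n \<nu>)" "\<lambda>z. 0" z] assms by simp
qed

lemma mixed_dbar_bump_inner:
  assumes "cmod z < 1/4"
  shows "mixed a b (dbar (bump n)) z = 0"
  using mixed_cong[of "ball 0 (1/4)" "dbar (bump n)" "\<lambda>z. 0" z] dbar_bump_inner assms by simp

text \<open>The weight is 2^(-k-1); \<open>dbar\<close> gains one factor 2 and the further
  derivatives gain 2^(a+b). The resulting coefficient is at most 1 as
  \<open>a + b \<le> k\<close>.\<close>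

lemma mixed_dbar_dyadic_Suc:
  assumes "a + b \<le> k"
  shows "mixed a b (dbar (dyadic (Suc k) (Suc \<nu>))) z = mixed a b (dbar (bump (Suc k))) z
    + (2 ^ (a + b) / 2 ^ k) * mixed a b (dbar (dyadic (Suc k) \<nu>)) (2 * z)"
proof -
  have "dbar (dyadic (Suc k) (Suc \<nu>))
      = (\<lambda>z. dbar (bump (Suc k)) z + (1 / 2 ^ Suc k * of_real 2) * dbar (dyadic (Suc k) \<nu>) (of_real 2 * z))"
    unfolding dyadic.simps
    by (rule dbar_add_scaled) (use Ck_bump[of "Suc k"] Ck_dyadic[of "Suc k"] in auto)
  then show ?thesis
    by (simp only: mixed_add_scaled[OF Ck_dbar[OF Ck_bump] Ck_dbar[OF Ck_dyadic] assms]) simp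
qed

text \<open>At each point at most one of the two summands of the recursion is nonzero: the bump term
  vanishes for |z| < 1/4, and for |z| \<ge> 1/4 the rescaled one does, since |2z| \<ge> 1/2 > 3/8. A
  bound for the bump therefore passes unchanged through the induction.\<close>

lemma mixed_dbar_dyadic_bounded:
  assumes "a + b \<le> k"
  shows "\<exists>M. \<forall>\<nu> z. cmod (mixed a b (dbar (dyadic (Suc k) \<nu>)) z) \<le> M"
proof -
  let ?g = "mixed a b (dbar (bump (Suc k)))"
  have "continuous_on UNIV ?g"
    using continuous_mixed[OF Ck_dbar[OF Ck_bump] assms] .
  then have "bounded (?g ` cball 0 1)"
    by (intro compact_imp_bounded compact_continuous_image) (auto intro: continuous_on_subset)
  then obtain M where M: "M > 0" "\<And>z. cmod z \<le> 1 \<Longrightarrow> cmod (?g z) \<le> M"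
    by (auto simp: bounded_pos)
  have "cmod (mixed a b (dbar (dyadic (Suc k) \<nu>)) z) \<le> M" for \<nu> z
  proof (induction \<nu> arbitrary: z)
    case 0
    then show ?case using M(1) by simp
  next
    case (Suc \<nu>)
    \<comment> \<open>\<open>M\<close> bounds the bump term on the unit disc only; beyond it the
      whole sum vanishes.\<close>
    consider "cmod z < 1/4" | "1/4 \<le> cmod z" "cmod z \<le> 1" | "cmod z > 1" by linarith
    then show ?case
    proof cases
      case 1
      have c: "cmod (2 ^ (a + b) / 2 ^ k) \<le> 1"
        using assms by (simp add: norm_divide norm_power del: power_add)
      have "cmod ((2 ^ (a + b) / 2 ^ k) * mixed a b (dbar (dyadic (Suc k) \<nu>)) (2 * z)) \<le> 1 * M"
        unfolding norm_mult by (intro mult_mono c Suc.IH) auto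
      then show ?thesis
        unfolding mixed_dbar_dyadic_Suc[OF assms] mixed_dbar_bump_inner[OF 1] by simp
    next
      case 2
      then have "mixed a b (dbar (dyadic (Suc k) \<nu>)) (2 * z) = 0"
        by (intro mixed_dbar_outer) (simp add: norm_mult)
      with 2 show ?thesis unfolding mixed_dbar_dyadic_Suc[OF assms] by (simp add: M(2))
    next
      case 3
      then show ?thesis using M(1) mixed_dbar_outer[of z] by (simp del: dyadic.simps)
    qed
  qed
  then show ?thesis by blast
qed

text \<open>The origin is fixed by doubling, and the gain 2^n of \<open>n\<close> derivatives
  cancels the weight 2^(-n). Each recursion step thus adds the n-th derivative of
  \<open>z ^ n\<close>.\<close>

lemma mixed_dyadic_at_0: "mixed n 0 (dyadic n \<nu>) 0 = of_nat \<nu> * fact n"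
proof (induction \<nu>)
  case (Suc \<nu>)
  have "mixed n 0 (bump n) 0 = mixed n 0 (\<lambda>z. z ^ n) 0"
    by (rule mixed_cong[where S = "ball 0 (1/4)"]) (auto simp: bump_def cutoff_eq_1)
  also have "\<dots> = fact n"
    by (simp add: mixed_def funpow_partial_x_power)
  finally have b: "mixed n 0 (bump n) 0 = fact n" .
  have "mixed n 0 (dyadic n (Suc \<nu>)) 0 = mixed n 0 (bump n) 0 + mixed n 0 (dyadic n \<nu>) 0"
    unfolding dyadic.simps by (subst mixed_add_scaled[OF Ck_bump Ck_dyadic]) auto
  then show ?case using Suc b by (simp add: algebra_simps)
qed simp

section \<open>Estimates for the C^k-norm and conclusion\<close>

lemma finite_orders: "finite {(a, b). a + b \<le> (k::nat)}"
  by (rule finite_subset[of _ "{..k} \<times> {..k}"]) auto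

lemma Ck_norm_le:
  assumes "S \<noteq> {}" "\<And>a b z. a + b \<le> k \<Longrightarrow> z \<in> S \<Longrightarrow> cmod (mixed a b u z) \<le> M a b"
  shows "Ck_norm k S u \<le> (\<Sum>(a, b) \<in> {(a, b). a + b \<le> k}. M a b)"
  unfolding Ck_norm_def mixed_def[symmetric]
  by (intro sum_mono) (use assms in \<open>auto intro!: cSUP_least\<close>)

text \<open>A real \<open>SUP\<close> dominates its members only if they are bounded above.
  Boundedness comes from continuity on the compact closure of \<open>S\<close>, hence the regularity
  assumption on the whole plane.\<close>

lemma Ck_norm_ge:
  assumes u: "Ck_on k UNIV u" and "bounded S" "z \<in> S" "a + b \<le> k"
  shows "cmod (mixed a b u z) \<le> Ck_norm k S u"
proof -
  let ?N = "\<lambda>(a, b). SUP z\<in>S. cmod (mixed a b u z)"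
  have up: "cmod (mixed a b u w) \<le> ?N (a, b)" if "a + b \<le> k" "w \<in> S" for a b w
  proof -
    have "bounded (mixed a b u ` closure S)"
      using assms(2) continuous_mixed[OF u that(1)]
      by (intro compact_imp_bounded compact_continuous_image) (auto intro: continuous_on_subset)
    then have "bounded (mixed a b u ` S)"
      by (rule bounded_subset) (use closure_subset in blast)
    then have "bdd_above ((\<lambda>z. cmod (mixed a b u z)) ` S)"
      by (simp add: bdd_above_norm[symmetric] image_image)
    then show ?thesis using that by (auto intro: cSUP_upper)
  qed
  have "?N (a, b) \<le> sum ?N {(a, b). a + b \<le> k}"
  proof (rule member_le_sum)
    \<comment> \<open>The other suprema are nonnegative, as each dominates the norm of a value at
      \<open>z\<close>.\<close>
    fix p assume "p \<in> {(a, b). a + b \<le> k} - {(a, b)}"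
    then show "0 \<le> ?N p" 
      using up[OF _ assms(3)] norm_ge_zero order_trans by (cases p) blast
  qed (use assms(4) finite_orders in auto)
  then show ?thesis
    using up[OF assms(4,3)] by (simp add: Ck_norm_def mixed_def)
qed

theorem proposition2:
  fixes k :: nat
  shows "\<exists>u :: nat \<Rightarrow> complex \<Rightarrow> complex.
           (\<forall>\<nu>. u \<nu> \<in> Ck_compact (k + 1) (ball 0 (1/2))) \<and>
           (\<exists>C. \<forall>\<nu>. Ck_norm k (ball 0 (1/2)) (dbar (u \<nu>)) \<le> C) \<and>
           filterlim (\<lambda>\<nu>. Ck_norm (k + 1) (ball 0 (1/2)) (u \<nu>)) at_top sequentially"
proof (intro exI[of _ "dyadic (Suc k)"] conjI allI)
  show "dyadic (Suc k) \<nu> \<in> Ck_compact (k + 1) (ball 0 (1/2))" for \<nu>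
    using dyadic_Ck_compact[of "Suc k"] by simp
  \<comment> \<open>\<open>M\<close> depends on the order of differentiation alone, so the sum of
    its values is a bound uniform in \<open>\<nu>\<close>.\<close>
  obtain M where "\<And>a b \<nu> z. a + b \<le> k \<Longrightarrow> cmod (mixed a b (dbar (dyadic (Suc k) \<nu>)) z) \<le> M a b"
    using mixed_dbar_dyadic_bounded[of _ _ k] by metis
  then have "Ck_norm k (ball 0 (1/2)) (dbar (dyadic (Suc k) \<nu>)) \<le> (\<Sum>(a, b) \<in> {(a, b). a + b \<le> k}. M a b)" for \<nu>
    by (intro Ck_norm_le) auto
  then show "\<exists>C. \<forall>\<nu>. Ck_norm k (ball 0 (1/2)) (dbar (dyadic (Suc k) \<nu>)) \<le> C"
    by blast
  \<comment> \<open>The single derivative (d/dx)^(k+1) at the origin already forces linear growth in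
    \<open>\<nu>\<close>.\<close>
  have "real \<nu> \<le> Ck_norm (k + 1) (ball 0 (1/2)) (dyadic (Suc k) \<nu>)" for \<nu>
  proof -
    have "real \<nu> * 1 \<le> real \<nu> * fact (Suc k)"
      by (intro mult_left_mono fact_ge_1) auto
    also have "\<dots> = cmod (mixed (Suc k) 0 (dyadic (Suc k) \<nu>) 0)"
      by (simp only: mixed_dyadic_at_0 norm_mult norm_of_nat norm_fact)
    also have "\<dots> \<le> Ck_norm (k + 1) (ball 0 (1/2)) (dyadic (Suc k) \<nu>)"
      using Ck_dyadic[of "Suc k"] by (intro Ck_norm_ge) (auto simp del: Ck_on.simps)
    finally show ?thesis by simp
  qed
  then show "filterlim (\<lambda>\<nu>. Ck_norm (k + 1) (ball 0 (1/2)) (dyadic (Suc k) \<nu>)) at_top sequentially"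
    by (intro filterlim_at_top_mono[OF filterlim_real_sequentially]) auto
qed

end
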